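(* Let $W$ be a $d$-dimensional random vector, $d\geq2$, and $Z\sim N(0,I_d)$. Suppose $$\mathcal{W}_p(W,Z)\leq Ap^\alpha\Delta\qquad\text{for all }1\leq p\leq p_0$$ with some constants $\alpha\geq0$, $A>0$, $\Delta>0$ and $p_0$ satisfying $|\log\Delta|\leq p_0/4$ and $\log(\kappa(d))\leq p_0/4$, where $\kappa(d):=2^{(d/2)-1}\Gamma(d/2)$. Suppose further that, for some constants $B_1,B_2$, $$d(d\log d)^\alpha\Delta\leq B_1$$ and $$d\,\Delta\,|\log\Delta|^\alpha\leq B_2\quad\text{if }0<\alpha\leq1/2 .$$ Then there exists a positive constant $C_{A,\alpha,B_1,B_2}$ depending only on $\alpha$, $A$, $B_1$ and $B_2$ such that $$\left|\frac{P(|W|>x)}{P(|Z|>x)}-1\right|\leq C_{A,\alpha,B_1,B_2}\,(1+x)\,(|\log\Delta|+d\log d+x^2)^\alpha\,\Delta$$ for all $0\leq x\leq\min\{\Delta^{-1/(2\alpha+1)},\sqrt{p_0}\}$.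
   Context: $|\cdot|$ is the Euclidean norm. For random vectors $X,Y\in\mathbb{R}^d$ and $p\ge1$, $\mathcal{W}_p(X,Y)=\big(\inf_\pi\int|x-y|^p\,\pi(dx,dy)\big)^{1/p}$, the infimum being over all probability measures $\pi$ on $\mathbb{R}^d\times\mathbb{R}^d$ with marginals the laws of $X$ and $Y$. $\Gamma$ is the Gamma function. *)

theory Defs
  imports "HOL-Probability.Probability"
begin

text \<open>
  The constant in the theorem is uniform in the dimension \<open>d\<close>, so \<open>d\<close> has to be quantified inside
  the formula and cannot be a type. Hence \<open>\<real>\<^sup>d\<close> is rendered as the product space over the index
  set \<open>{..<d}\<close>, whose points are the functions in \<open>{..<d} \<rightarrow>\<^sub>E UNIV\<close>. For the same reason (the
  constant must not depend on the type of the sample space either) random vectors enter through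
  their laws, which are measures on this space; all quantities involved depend on the laws only.
\<close>

definition Rd :: "nat \<Rightarrow> (nat \<Rightarrow> real) measure" where
  "Rd d = PiM {..<d} (\<lambda>_. borel)"

definition random_vector_law :: "nat \<Rightarrow> (nat \<Rightarrow> real) measure \<Rightarrow> bool" where
  "random_vector_law d \<mu> \<longleftrightarrow> prob_space \<mu> \<and> sets \<mu> = sets (Rd d)"

definition vnorm :: "nat \<Rightarrow> (nat \<Rightarrow> real) \<Rightarrow> real" where
  "vnorm d x = L2_set x {..<d}"

definition std_gaussian :: "nat \<Rightarrow> (nat \<Rightarrow> real) measure" where
  "std_gaussian d = PiM {..<d} (\<lambda>_. density lborel (\<lambda>t. ennreal (std_normal_density t)))"

definition couplings ::
    "nat \<Rightarrow> (nat \<Rightarrow> real) measure \<Rightarrow> (nat \<Rightarrow> real) measure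
      \<Rightarrow> ((nat \<Rightarrow> real) \<times> (nat \<Rightarrow> real)) measure set" where
  "couplings d \<mu> \<nu> = {\<pi>. prob_space \<pi> \<and> sets \<pi> = sets (Rd d \<Otimes>\<^sub>M Rd d) \<and>
     distr \<pi> (Rd d) fst = \<mu> \<and> distr \<pi> (Rd d) snd = \<nu>}"

definition transport_cost ::
    "nat \<Rightarrow> real \<Rightarrow> (nat \<Rightarrow> real) measure \<Rightarrow> (nat \<Rightarrow> real) measure \<Rightarrow> ennreal" where
  "transport_cost d p \<mu> \<nu> =
     (INF \<pi>\<in>couplings d \<mu> \<nu>. \<integral>\<^sup>+ (x, y). ennreal (vnorm d (\<lambda>i. x i - y i) powr p) \<partial>\<pi>)"

text \<open>
  The Wasserstein distance is \<open>\<infinity>\<close> if no coupling has finite cost. There is no real power on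
  \<^typ>\<open>ennreal\<close>, hence the case distinction.
\<close>

definition wasserstein ::
    "nat \<Rightarrow> real \<Rightarrow> (nat \<Rightarrow> real) measure \<Rightarrow> (nat \<Rightarrow> real) measure \<Rightarrow> ennreal" where
  "wasserstein d p \<mu> \<nu> =
     (if transport_cost d p \<mu> \<nu> = \<infinity> then \<infinity>
      else ennreal (enn2real (transport_cost d p \<mu> \<nu>) powr (1 / p)))"

definition norm_tail :: "nat \<Rightarrow> (nat \<Rightarrow> real) measure \<Rightarrow> real \<Rightarrow> real" where
  "norm_tail d \<mu> x = measure \<mu> {w \<in> space \<mu>. vnorm d w > x}"

definition kappa :: "nat \<Rightarrow> real" where
  "kappa d = 2 powr (real d / 2 - 1) * Gamma (real d / 2)"

end

theory Submission
  imports Defs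
begin

text \<open>
  Everything rests on one property of the tail \<open>S x = P(|Z| > x)\<close>, valid in each dimension
  \<open>d \<ge> 2\<close> with constants that do not involve \<open>d\<close>: the function \<open>exp (x\<^sup>2 / 2) * S x\<close> is
  nondecreasing on \<open>x \<ge> 0\<close> and equals \<open>1\<close> at \<open>0\<close>. In other words, the hazard rate of \<open>|Z|\<close> at \<open>x\<close>
  is at most \<open>x\<close>. To see this, single out two coordinates: \<open>Z\<^sub>0\<^sup>2 + Z\<^sub>1\<^sup>2\<close> is exponential with
  mean \<open>2\<close> (\<open>chi_square_two_tail\<close>), so conditioning on the rest \<open>R = Z\<^sub>2\<^sup>2 + \<dots>\<close> gives
  \<open>P(|Z|\<^sup>2 > s) = E exp (- max (s - R) 0 / 2)\<close> (\<open>std_gaussian_square_tail\<close>), and raising \<open>s\<close> by \<open>h\<close>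
  costs at most a factor \<open>exp (- h / 2)\<close> inside the expectation. The consequences are
  \<open>S x \<ge> exp (- x\<^sup>2 / 2)\<close>, \<open>S (x - t) \<le> exp (t * x) * S x\<close> and
  \<open>S (x + t) \<ge> (1 - t * (1 + x)) * S x\<close>.

  Now let \<open>w = A * p powr \<alpha> * \<Delta>\<close> bound the \<open>p\<close>-th Wasserstein distance, and put \<open>t = 2 * e * w\<close>.
  Markov's inequality for the \<open>p\<close>-th power, applied to a coupling with cost at most
  \<open>(2 * w) powr p\<close>, shows that \<open>|W - Z| \<ge> t\<close> has probability at most \<open>exp (- p)\<close>. Hence \<open>P(|W| > x)\<close> lies
  between \<open>S (x + t) - exp (- p)\<close> and \<open>S (x - t) + exp (- p)\<close>. The choice
  \<open>p = max 1 (\<bar>ln \<Delta>\<bar> + x\<^sup>2 / 2)\<close> makes \<open>exp (- p) \<le> \<Delta> * S x\<close>, keeps \<open>p \<le> p0\<close>, and bounds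
  \<open>p\<close> by \<open>\<bar>ln \<Delta>\<bar> + d * ln d + x\<^sup>2\<close>. The restriction \<open>x \<le> \<Delta> powr (- 1 / (2 * \<alpha> + 1))\<close> is what
  keeps \<open>t * x\<close> bounded (\<open>moment_order_cost_bound\<close>), so that \<open>exp (t * x) - 1\<close> is of order
  \<open>t * x\<close>; the relative error is then of order \<open>t * (1 + x) + \<Delta>\<close> (\<open>tail_ratio_bound\<close>).

  This argument needs \<open>\<Delta> < 1\<close> and \<open>p0 \<ge> 1\<close>. Otherwise \<open>x \<le> 1\<close> while \<open>\<Delta>\<close> is bounded below, and the
  trivial bound \<open>1 / S x\<close> suffices (\<open>tail_ratio_trivial\<close>).
\<close>

section \<open>The squared norm of a two-dimensional Gaussian vector\<close>

text \<open>
  The substitution \<open>z = y * u\<close> in the plane produces this integral in \<open>y\<close> with \<open>k = 1 + u\<^sup>2\<close>. The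
  factor \<open>\<bar>y\<bar>\<close>, the Jacobian, gives the integrand an elementary antiderivative on each half-line.
\<close>

lemma nn_integral_radial_tail:
  fixes k s :: real
  assumes k: "k > 0"
  shows "(\<integral>\<^sup>+ y. ennreal (\<bar>y\<bar> * exp (- (k * y\<^sup>2) / 2)) * indicator {y. k * y\<^sup>2 > s} y \<partial>lborel)
    = ennreal (exp (- max s 0 / 2) * (2 / k))"
proof -
  define a where "a = sqrt (max s 0 / k)"
  have a: "a \<ge> 0" "k * a\<^sup>2 = max s 0" using k by (auto simp: a_def)
  define f where "f = (\<lambda>y::real. y * exp (- (k * y\<^sup>2) / 2))"
  have [measurable]: "f \<in> borel_measurable borel" by (simp add: f_def)
  define T where "T = (\<integral>\<^sup>+ y. ennreal (f y) * indicator {a ..} y \<partial>lborel)"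
  have "T = ennreal (0 - (- exp (- (k * a\<^sup>2) / 2) / k))"
    unfolding T_def
  proof (rule nn_integral_FTC_atLeast)
    show "DERIV (\<lambda>y. - exp (- (k * y\<^sup>2) / 2) / k) y :> f y" for y
      unfolding f_def using k by (auto intro!: derivative_eq_intros)
    show "0 \<le> f y" if "a \<le> y" for y using that a by (simp add: f_def)
    have "filterlim (\<lambda>y::real. (k / 2) * y\<^sup>2) at_top at_top"
      using k by (intro filterlim_tendsto_pos_mult_at_top[OF tendsto_const] filterlim_pow_at_top filterlim_ident) auto
    then have "filterlim (\<lambda>y::real. k * y\<^sup>2 / 2) at_top at_top" by simp
    then have "((\<lambda>y::real. exp (- (k * y\<^sup>2 / 2))) \<longlongrightarrow> 0) at_top"
      by (intro filterlim_compose[OF exp_at_bot] filterlim_compose[OF filterlim_uminus_at_bot_at_top])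
    then have "((\<lambda>y::real. - exp (- (k * y\<^sup>2 / 2)) / k) \<longlongrightarrow> - 0 / k) at_top"
      using k by (intro tendsto_intros) auto
    then show "((\<lambda>y. - exp (- (k * y\<^sup>2) / 2) / k) \<longlongrightarrow> 0) at_top" by simp
  qed measurable
  then have T: "T = ennreal (exp (- max s 0 / 2) / k)" by (simp add: a(2))
  have refl: "T = (\<integral>\<^sup>+ y. ennreal (f (- y)) * indicator {a ..} (- y) \<partial>lborel)"
    unfolding T_def by (subst nn_integral_real_affine[of _ "-1" 0]) auto
  have "AE y in lborel. y \<noteq> a \<and> y \<noteq> - a"
    using AE_lborel_singleton[of a] AE_lborel_singleton[of "- a"] by eventually_elim auto
  then have "AE y in lborel. ennreal (\<bar>y\<bar> * exp (- (k * y\<^sup>2) / 2)) * indicator {y. k * y\<^sup>2 > s} y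
     = ennreal (f y) * indicator {a ..} y + ennreal (f (- y)) * indicator {a ..} (- y)"
  proof eventually_elim
    case (elim y)
    have iff: "k * y\<^sup>2 > s \<longleftrightarrow> a < \<bar>y\<bar>"
    proof
      assume "a < \<bar>y\<bar>"
      then have "a\<^sup>2 < y\<^sup>2" using a(1) by (metis power2_abs power_strict_mono zero_less_numeral)
      then have "k * a\<^sup>2 < k * y\<^sup>2" using k by simp
      then show "k * y\<^sup>2 > s" using a(2) by simp
    next
      assume s: "k * y\<^sup>2 > s"
      show "a < \<bar>y\<bar>"
      proof (rule ccontr)
        assume "\<not> a < \<bar>y\<bar>"
        then have lt: "\<bar>y\<bar> < a" using elim by linarith
        then have "y\<^sup>2 < a\<^sup>2" by (metis abs_ge_zero power2_abs power_strict_mono zero_less_numeral)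
        then have "k * y\<^sup>2 < max s 0" using k a(2) by (metis mult_strict_left_mono)
        moreover have "0 \<le> k * y\<^sup>2" using k by simp
        ultimately show False using s by linarith
      qed
    qed
    show ?case
    proof (cases "y \<ge> 0")
      case True
      then show ?thesis using elim a(1) by (auto simp: iff f_def indicator_def)
    next
      case False
      then show ?thesis using elim a(1) by (auto simp: iff f_def indicator_def)
    qed
  qed
  then have "(\<integral>\<^sup>+ y. ennreal (\<bar>y\<bar> * exp (- (k * y\<^sup>2) / 2)) * indicator {y. k * y\<^sup>2 > s} y \<partial>lborel)
     = (\<integral>\<^sup>+ y. ennreal (f y) * indicator {a ..} y + ennreal (f (- y)) * indicator {a ..} (- y) \<partial>lborel)"
    by (rule nn_integral_cong_AE)
  also have "\<dots> = T + T"
    by (subst nn_integral_add) (auto simp: T_def refl[unfolded T_def, symmetric])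
  finally show ?thesis using k by (simp add: T ennreal_plus[symmetric] del: ennreal_plus)
qed

text \<open>
  A constant rather than the density expression itself, so that simplification does not expand
  integrals over product spaces into Lebesgue integrals of densities.
\<close>

definition std_normal :: "real measure" where
  "std_normal = density lborel (\<lambda>t. ennreal (std_normal_density t))"

lemma sets_std_normal [measurable_cong, simp]: "sets std_normal = sets borel"
  and space_std_normal [simp]: "space std_normal = UNIV"
  by (simp_all add: std_normal_def)

lemma prob_space_std_normal: "prob_space std_normal"
  unfolding std_normal_def by (rule prob_space_normal_density) simp

text \<open>
  Integrating along the lines \<open>z = y * u\<close> first, the threshold \<open>s\<close> enters only through the factor
  \<open>exp (- max s 0 / 2)\<close>, which does not depend on the slope \<open>u\<close>. What remains is a constant \<open>J\<close>;
  a negative threshold, for which the probability is \<open>1\<close>, shows \<open>J = 1\<close> without evaluating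
  the integral over \<open>u\<close>.
\<close>

lemma chi_square_two_tail:
  "(\<integral>\<^sup>+ y. (\<integral>\<^sup>+ z. indicator {z. y\<^sup>2 + z\<^sup>2 > s} z \<partial>std_normal) \<partial>std_normal) = ennreal (exp (- max s 0 / 2))"
proof -
  define G where "G s = (\<integral>\<^sup>+ y. (\<integral>\<^sup>+ z. indicator {z::real. y\<^sup>2 + z\<^sup>2 > s} z \<partial>std_normal) \<partial>std_normal)" for s :: real
  define J where "J = (\<integral>\<^sup>+ (u::real). ennreal (1 / (2 * pi)) * ennreal (2 / (1 + u\<^sup>2)) \<partial>lborel)"
  have split: "G s = ennreal (exp (- max s 0 / 2)) * J" for s
  proof -
    let ?\<phi> = "\<lambda>y. ennreal (std_normal_density y)"
    have "G s = (\<integral>\<^sup>+ y. ?\<phi> y * (\<integral>\<^sup>+ z. ?\<phi> z * indicator {z. y\<^sup>2 + z\<^sup>2 > s} z \<partial>lborel) \<partial>lborel)"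
    proof -
      have inner: "(\<integral>\<^sup>+ z. indicator {z. y\<^sup>2 + z\<^sup>2 > s} z \<partial>std_normal)
          = (\<integral>\<^sup>+ z. ?\<phi> z * indicator {z. y\<^sup>2 + z\<^sup>2 > s} z \<partial>lborel)" for y :: real
        unfolding std_normal_def by (rule nn_integral_density) measurable
      show ?thesis unfolding G_def inner unfolding std_normal_def by (rule nn_integral_density) measurable
    qed
    also have "\<dots> = (\<integral>\<^sup>+ y. (\<integral>\<^sup>+ u. ennreal (1 / (2 * pi)) * (ennreal (\<bar>y\<bar> * exp (- ((1 + u\<^sup>2) * y\<^sup>2) / 2))
            * indicator {y. (1 + u\<^sup>2) * y\<^sup>2 > s} y) \<partial>lborel) \<partial>lborel)"
    proof (rule nn_integral_cong_AE)
      show "AE y in lborel. ?\<phi> y * (\<integral>\<^sup>+ z. ?\<phi> z * indicator {z. y\<^sup>2 + z\<^sup>2 > s} z \<partial>lborel)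
         = (\<integral>\<^sup>+ u. ennreal (1 / (2 * pi)) * (ennreal (\<bar>y\<bar> * exp (- ((1 + u\<^sup>2) * y\<^sup>2) / 2))
            * indicator {y. (1 + u\<^sup>2) * y\<^sup>2 > s} y) \<partial>lborel)"
        using AE_lborel_singleton[of 0]
      proof eventually_elim
        case (elim y)
        have dens: "std_normal_density y * \<bar>y\<bar> * std_normal_density (y * u)
            = 1 / (2 * pi) * (\<bar>y\<bar> * exp (- ((1 + u\<^sup>2) * y\<^sup>2) / 2))" for u
          by (simp add: std_normal_density_def exp_add[symmetric] power_mult_distrib field_simps
              flip: real_sqrt_mult)
        have "?\<phi> y * (\<integral>\<^sup>+ z. ?\<phi> z * indicator {z. y\<^sup>2 + z\<^sup>2 > s} z \<partial>lborel)
           = ?\<phi> y * (\<bar>y\<bar> * (\<integral>\<^sup>+ u. ?\<phi> (y * u) * indicator {z. y\<^sup>2 + z\<^sup>2 > s} (y * u) \<partial>lborel))"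
          using elim by (subst nn_integral_real_affine[of _ y 0]) auto
        also have "\<dots> = (\<integral>\<^sup>+ u. ?\<phi> y * (\<bar>y\<bar> * (?\<phi> (y * u) * indicator {z. y\<^sup>2 + z\<^sup>2 > s} (y * u))) \<partial>lborel)"
          by (simp add: nn_integral_cmult)
        also have "\<dots> = (\<integral>\<^sup>+ u. ennreal (1 / (2 * pi)) * (ennreal (\<bar>y\<bar> * exp (- ((1 + u\<^sup>2) * y\<^sup>2) / 2))
            * indicator {y. (1 + u\<^sup>2) * y\<^sup>2 > s} y) \<partial>lborel)"
        proof (rule nn_integral_cong)
          fix u :: real
          have ind: "indicator {z. y\<^sup>2 + z\<^sup>2 > s} (y * u) = (indicator {y. (1 + u\<^sup>2) * y\<^sup>2 > s} y :: ennreal)"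
            by (simp add: indicator_def power_mult_distrib algebra_simps)
          have "?\<phi> y * (ennreal \<bar>y\<bar> * ?\<phi> (y * u))
              = ennreal (1 / (2 * pi)) * ennreal (\<bar>y\<bar> * exp (- ((1 + u\<^sup>2) * y\<^sup>2) / 2))"
            using dens[of u] by (simp only: ennreal_mult[symmetric] normal_density_nonneg abs_ge_zero
                mult_nonneg_nonneg mult.assoc exp_ge_zero divide_nonneg_nonneg pi_ge_zero zero_le_numeral zero_le_one)
          then show "?\<phi> y * (\<bar>y\<bar> * (?\<phi> (y * u) * indicator {z. y\<^sup>2 + z\<^sup>2 > s} (y * u)))
            = ennreal (1 / (2 * pi)) * (ennreal (\<bar>y\<bar> * exp (- ((1 + u\<^sup>2) * y\<^sup>2) / 2))
            * indicator {y. (1 + u\<^sup>2) * y\<^sup>2 > s} y)"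
            unfolding ind by (simp add: mult.assoc[symmetric])
        qed
        finally show ?case .
      qed
    qed
    also have "\<dots> = (\<integral>\<^sup>+ u. (\<integral>\<^sup>+ y. ennreal (1 / (2 * pi)) * (ennreal (\<bar>y\<bar> * exp (- ((1 + u\<^sup>2) * y\<^sup>2) / 2))
            * indicator {y. (1 + u\<^sup>2) * y\<^sup>2 > s} y) \<partial>lborel) \<partial>lborel)"
      by (rule lborel_pair.Fubini') measurable
    also have "\<dots> = (\<integral>\<^sup>+ u. ennreal (exp (- max s 0 / 2)) * (ennreal (1 / (2 * pi)) * ennreal (2 / (1 + u\<^sup>2))) \<partial>lborel)"
    proof (rule nn_integral_cong)
      fix u :: real
      have "1 + u\<^sup>2 > 0" by (simp add: add_pos_nonneg)
      note radial = nn_integral_radial_tail[OF this, of s]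
      have "ennreal (exp (- max s 0 / 2) * (2 / (1 + u\<^sup>2))) = ennreal (exp (- max s 0 / 2)) * ennreal (2 / (1 + u\<^sup>2))"
        by (rule ennreal_mult) auto
      with radial show "(\<integral>\<^sup>+ y. ennreal (1 / (2 * pi)) * (ennreal (\<bar>y\<bar> * exp (- ((1 + u\<^sup>2) * y\<^sup>2) / 2))
            * indicator {y. (1 + u\<^sup>2) * y\<^sup>2 > s} y) \<partial>lborel)
          = ennreal (exp (- max s 0 / 2)) * (ennreal (1 / (2 * pi)) * ennreal (2 / (1 + u\<^sup>2)))"
        by (subst nn_integral_cmult) (simp_all only: mult.left_commute, measurable)
    qed
    also have "\<dots> = ennreal (exp (- max s 0 / 2)) * J"
      unfolding J_def by (rule nn_integral_cmult) measurable
    finally show ?thesis .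
  qed
  interpret prob_space std_normal by (rule prob_space_std_normal)
  have "{z. y\<^sup>2 + z\<^sup>2 > -1} = UNIV" for y :: real
    by (auto intro: less_le_trans[of "-1" 0])
  then have "G (-1) = 1"
    unfolding G_def using emeasure_space_1 by simp
  then have "J = 1" using split[of "-1"] by simp
  then show ?thesis using split[of s] by (simp add: G_def)
qed


section \<open>The tail of the Gaussian norm\<close>

lemma std_gaussian_eq: "std_gaussian d = PiM {..<d} (\<lambda>_. std_normal)"
  by (simp add: std_gaussian_def std_normal_def)

lemma prob_space_std_gaussian: "prob_space (std_gaussian d)"
  unfolding std_gaussian_eq by (rule prob_space_PiM) (rule prob_space_std_normal)

lemma measurable_vnorm [measurable]: "vnorm d \<in> borel_measurable (Rd d)"
  unfolding vnorm_def[abs_def] L2_set_def Rd_def by measurable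

lemma measurable_vnorm_diff [measurable]:
  "(\<lambda>z. vnorm d (\<lambda>i. fst z i - snd z i)) \<in> borel_measurable (Rd d \<Otimes>\<^sub>M Rd d)"
  unfolding vnorm_def[abs_def] L2_set_def Rd_def by measurable

lemma vnorm_nonneg: "vnorm d x \<ge> 0"
  by (simp add: vnorm_def L2_set_nonneg)

lemma std_gaussian_square_tail:
  assumes "d \<ge> 2"
  shows "emeasure (std_gaussian d) {w \<in> space (std_gaussian d). s < (vnorm d w)\<^sup>2}
    = (\<integral>\<^sup>+ x. ennreal (exp (- max (s - (\<Sum>i\<in>{2..<d}. (x i)\<^sup>2)) 0 / 2)) \<partial>PiM {2..<d} (\<lambda>_. std_normal))"
proof -
  interpret product_sigma_finite "\<lambda>_::nat. std_normal"
    by (intro product_sigma_finite.intro prob_space_imp_sigma_finite prob_space_std_normal)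
  let ?I = "{2..<d}"
  have I: "{..<d} = insert 0 (insert 1 ?I)" using assms by auto
  define f :: "(nat \<Rightarrow> real) \<Rightarrow> ennreal" where "f w = indicator {w. s < (\<Sum>i<d. (w i)\<^sup>2)} w" for w
  have [measurable]: "f \<in> borel_measurable (PiM (insert 0 (insert 1 ?I)) (\<lambda>_. std_normal))"
    unfolding f_def I[symmetric] by measurable
  have [measurable]: "(\<lambda>x. \<integral>\<^sup>+ z. f (x(0 := z)) \<partial>std_normal) \<in> borel_measurable (PiM (insert 1 ?I) (\<lambda>_. std_normal))"
  proof -
    interpret prob_space std_normal by (rule prob_space_std_normal)
    show ?thesis by measurable
  qed
  have "{w \<in> space (std_gaussian d). s < (vnorm d w)\<^sup>2} = {w \<in> space (std_gaussian d). s < (\<Sum>i<d. (w i)\<^sup>2)}"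
    by (simp add: vnorm_def L2_set_def sum_nonneg)
  also have "emeasure (std_gaussian d) \<dots> = integral\<^sup>N (std_gaussian d) f"
  proof -
    let ?S = "{w \<in> space (std_gaussian d). s < (\<Sum>i<d. (w i)\<^sup>2)}"
    have "?S \<in> sets (std_gaussian d)" unfolding std_gaussian_eq by measurable
    then have "emeasure (std_gaussian d) ?S = integral\<^sup>N (std_gaussian d) (indicator ?S)"
      by (rule nn_integral_indicator[symmetric])
    also have "\<dots> = integral\<^sup>N (std_gaussian d) f"
      by (rule nn_integral_cong) (simp add: f_def indicator_def)
    finally show ?thesis .
  qed
  also have "\<dots> = (\<integral>\<^sup>+ x. \<integral>\<^sup>+ z. f (x(0 := z)) \<partial>std_normal \<partial>PiM (insert 1 ?I) (\<lambda>_. std_normal))"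
    unfolding std_gaussian_eq I by (rule product_nn_integral_insert) (simp_all del: One_nat_def)
  also have "\<dots> = (\<integral>\<^sup>+ x. \<integral>\<^sup>+ y. \<integral>\<^sup>+ z. f (x(1 := y, 0 := z)) \<partial>std_normal \<partial>std_normal \<partial>PiM ?I (\<lambda>_. std_normal))"
    by (rule product_nn_integral_insert) (simp_all del: One_nat_def)
  also have "\<dots> = (\<integral>\<^sup>+ x. ennreal (exp (- max (s - (\<Sum>i\<in>?I. (x i)\<^sup>2)) 0 / 2)) \<partial>PiM ?I (\<lambda>_. std_normal))"
  proof (rule nn_integral_cong)
    fix x :: "nat \<Rightarrow> real"
    let ?R = "\<Sum>i\<in>?I. (x i)\<^sup>2"
    have "f (x(1 := y, 0 := z)) = indicator {z. y\<^sup>2 + z\<^sup>2 > s - ?R} z" for y z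
    proof -
      have "(\<Sum>i<d. ((x(1 := y, 0 := z)) i)\<^sup>2) = z\<^sup>2 + (y\<^sup>2 + ?R)"
        unfolding I by (simp cong: sum.cong_simp)
      then show ?thesis by (auto simp: f_def indicator_def)
    qed
    then show "(\<integral>\<^sup>+ y. \<integral>\<^sup>+ z. f (x(1 := y, 0 := z)) \<partial>std_normal \<partial>std_normal)
        = ennreal (exp (- max (s - ?R) 0 / 2))"
      using chi_square_two_tail[of "s - ?R"] by simp
  qed
  finally show ?thesis .
qed

lemma norm_tail_square:
  assumes "x \<ge> 0"
  shows "norm_tail d \<mu> x = measure \<mu> {w \<in> space \<mu>. x\<^sup>2 < (vnorm d w)\<^sup>2}"
  unfolding norm_tail_def using assms vnorm_nonneg[of d]
  by (intro arg_cong[where f = "measure \<mu>"]) (auto intro: power_strict_mono power2_less_imp_less)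

text \<open>
  Raising the threshold from \<open>x\<^sup>2\<close> to \<open>y\<^sup>2\<close> raises \<open>max (s - R) 0\<close> by at most \<open>y\<^sup>2 - x\<^sup>2\<close>,
  whatever the value of the remaining coordinates.
\<close>

lemma std_gaussian_tail_decay:
  assumes d: "d \<ge> 2" and xy: "0 \<le> x" "x \<le> y"
  shows "exp (- (y\<^sup>2 - x\<^sup>2) / 2) * norm_tail d (std_gaussian d) x \<le> norm_tail d (std_gaussian d) y"
proof -
  interpret prob_space "std_gaussian d" by (rule prob_space_std_gaussian)
  have sq: "x\<^sup>2 \<le> y\<^sup>2" using xy by (simp add: power_mono)
  have "ennreal (exp (- (y\<^sup>2 - x\<^sup>2) / 2)) * emeasure (std_gaussian d) {w \<in> space (std_gaussian d). x\<^sup>2 < (vnorm d w)\<^sup>2}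
    = (\<integral>\<^sup>+ w. ennreal (exp (- (y\<^sup>2 - x\<^sup>2) / 2)) * ennreal (exp (- max (x\<^sup>2 - (\<Sum>i\<in>{2..<d}. (w i)\<^sup>2)) 0 / 2)) \<partial>PiM {2..<d} (\<lambda>_. std_normal))"
    unfolding std_gaussian_square_tail[OF d] by (rule nn_integral_cmult[symmetric]) measurable
  also have "\<dots> \<le> emeasure (std_gaussian d) {w \<in> space (std_gaussian d). y\<^sup>2 < (vnorm d w)\<^sup>2}"
    unfolding std_gaussian_square_tail[OF d] ennreal_mult[OF exp_ge_zero exp_ge_zero, symmetric] exp_add[symmetric]
    using sq by (intro nn_integral_mono ennreal_leI) (auto simp: max_def field_simps)
  finally show ?thesis
    unfolding norm_tail_square[OF xy(1)] norm_tail_square[OF order_trans[OF xy]] emeasure_eq_measure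
    by (simp add: ennreal_mult[symmetric])
qed

lemma std_gaussian_tail_lower:
  assumes d: "d \<ge> 2" and x: "0 \<le> x"
  shows "exp (- x\<^sup>2 / 2) \<le> norm_tail d (std_gaussian d) x"
proof -
  interpret prob_space "std_gaussian d" by (rule prob_space_std_gaussian)
  interpret P: prob_space "PiM {2..<d} (\<lambda>_. std_normal)" by (rule prob_space_PiM) (rule prob_space_std_normal)
  have "ennreal (exp (- x\<^sup>2 / 2)) = (\<integral>\<^sup>+ w. ennreal (exp (- x\<^sup>2 / 2)) \<partial>PiM {2..<d} (\<lambda>_. std_normal))"
    by (simp add: P.emeasure_space_1)
  also have "\<dots> \<le> emeasure (std_gaussian d) {w \<in> space (std_gaussian d). x\<^sup>2 < (vnorm d w)\<^sup>2}"
    unfolding std_gaussian_square_tail[OF d]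
    by (intro nn_integral_mono ennreal_leI) (auto simp: max_def sum_nonneg)
  finally show ?thesis
    unfolding norm_tail_square[OF x] emeasure_eq_measure by simp
qed

lemma norm_tail_nonneg: "norm_tail d \<mu> x \<ge> 0"
  by (simp add: norm_tail_def)

lemma norm_tail_le_1: "prob_space \<mu> \<Longrightarrow> norm_tail d \<mu> x \<le> 1"
  by (simp add: norm_tail_def prob_space.prob_le_1)

text \<open>
  For \<open>t > x\<close> the decay estimate is not available between \<open>x - t\<close> and \<open>x\<close>; there \<open>S (x - t) \<le> 1\<close> and
  the lower bound on \<open>S x\<close> combine with \<open>x\<^sup>2 / 2 \<le> t * x\<close>.
\<close>

lemma std_gaussian_tail_shift_left:
  assumes d: "d \<ge> 2" and x: "0 \<le> x" and t: "0 \<le> t"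
  shows "norm_tail d (std_gaussian d) (x - t) \<le> exp (t * x) * norm_tail d (std_gaussian d) x"
proof -
  let ?S = "norm_tail d (std_gaussian d)"
  have sq: "0 \<le> t\<^sup>2" "0 \<le> x\<^sup>2" by simp_all
  show ?thesis
  proof (cases "t \<le> x")
    case True
    define D where "D = (x\<^sup>2 - (x - t)\<^sup>2) / 2"
    have "- (x\<^sup>2 - (x - t)\<^sup>2) / 2 = - D" by (simp only: D_def minus_divide_left)
    then have decay: "exp (- D) * ?S (x - t) \<le> ?S x"
      using std_gaussian_tail_decay[OF d, of "x - t" x] True t by simp
    have "?S (x - t) = exp D * (exp (- D) * ?S (x - t))"
      by (simp add: mult.assoc[symmetric] exp_add[symmetric])
    also have "\<dots> \<le> exp D * ?S x"
      by (intro mult_left_mono decay) simp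
    also have "\<dots> \<le> exp (t * x) * ?S x"
      using sq by (intro mult_right_mono norm_tail_nonneg) (simp add: D_def power2_eq_square field_simps)
    finally show ?thesis .
  next
    case False
    have "?S (x - t) \<le> exp (x\<^sup>2 / 2) * exp (- x\<^sup>2 / 2)"
      using norm_tail_le_1[OF prob_space_std_gaussian] by (simp add: exp_add[symmetric])
    also have "\<dots> \<le> exp (x\<^sup>2 / 2) * ?S x"
      by (intro mult_left_mono std_gaussian_tail_lower d x) auto
    also have "\<dots> \<le> exp (t * x) * ?S x"
    proof (intro mult_right_mono norm_tail_nonneg)
      have "x * x \<le> t * x" using False x by (intro mult_right_mono) auto
      moreover have "0 \<le> x * x" by simp
      ultimately show "exp (x\<^sup>2 / 2) \<le> exp (t * x)" unfolding exp_le_cancel_iff power2_eq_square by linarith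
    qed
    finally show ?thesis .
  qed
qed

text \<open>
  The exponent lost is \<open>t * x + t\<^sup>2 / 2\<close>. For \<open>t \<le> 1\<close> the quadratic term is absorbed in \<open>t\<close>, and for
  \<open>t > 1\<close> the left-hand side is not positive, so \<open>t\<close> need not be bounded.
\<close>

lemma std_gaussian_tail_shift_right:
  assumes d: "d \<ge> 2" and x: "0 \<le> x" and t: "0 \<le> t"
  shows "(1 - t * (1 + x)) * norm_tail d (std_gaussian d) x \<le> norm_tail d (std_gaussian d) (x + t)"
proof -
  let ?S = "norm_tail d (std_gaussian d)"
  have "1 - t * (1 + x) \<le> exp (- ((x + t)\<^sup>2 - x\<^sup>2) / 2)"
  proof (cases "t \<le> 1")
    case True
    have "t * t \<le> t" using t True by (simp add: mult_left_le)
    then have "1 - t * (1 + x) \<le> 1 + (- ((x + t)\<^sup>2 - x\<^sup>2) / 2)"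
      using t by (simp add: power2_eq_square field_simps)
    also have "\<dots> \<le> exp (- ((x + t)\<^sup>2 - x\<^sup>2) / 2)" by (rule exp_ge_add_one_self)
    finally show ?thesis .
  next
    case False
    then have "1 * 1 \<le> t * (1 + x)" using x by (intro mult_mono) auto
    then show ?thesis using exp_ge_zero[of "- ((x + t)\<^sup>2 - x\<^sup>2) / 2"] by linarith
  qed
  then have "(1 - t * (1 + x)) * ?S x \<le> exp (- ((x + t)\<^sup>2 - x\<^sup>2) / 2) * ?S x"
    by (intro mult_right_mono norm_tail_nonneg)
  also have "\<dots> \<le> ?S (x + t)" by (rule std_gaussian_tail_decay[OF d x]) (use t in simp)
  finally show ?thesis .
qed

section \<open>From Wasserstein distance to tails\<close>

text \<open>
  The infimum over couplings need not be shown to be attained: any slack \<open>w' > w\<close> yields a coupling.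
\<close>

lemma wasserstein_near_optimal_coupling:
  assumes w: "wasserstein d p \<mu> \<nu> \<le> ennreal w" and p: "p > 0" and w': "0 \<le> w" "w < w'"
  obtains \<pi> where "\<pi> \<in> couplings d \<mu> \<nu>"
    "(\<integral>\<^sup>+ z. ennreal (vnorm d (\<lambda>i. fst z i - snd z i) powr p) \<partial>\<pi>) \<le> ennreal (w' powr p)"
proof -
  let ?c = "transport_cost d p \<mu> \<nu>"
  have fin: "?c \<noteq> \<infinity>" using w by (auto simp: wasserstein_def top_unique)
  then have "enn2real ?c powr (1 / p) \<le> w"
    using w w' by (simp add: wasserstein_def)
  then have "(enn2real ?c powr (1 / p)) powr p \<le> w powr p"
    using p by (intro powr_mono2) auto
  then have "enn2real ?c \<le> w powr p"
    using p by (simp add: powr_powr)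
  also have "\<dots> < w' powr p"
    using p w' by (intro powr_less_mono2) auto
  finally have "ennreal (enn2real ?c) < ennreal (w' powr p)"
    by (simp add: ennreal_less_iff)
  then have "?c < ennreal (w' powr p)"
    using fin by (simp add: top.not_eq_extremum)
  then obtain \<pi> where "\<pi> \<in> couplings d \<mu> \<nu>"
    "(\<integral>\<^sup>+ (x, y). ennreal (vnorm d (\<lambda>i. x i - y i) powr p) \<partial>\<pi>) < ennreal (w' powr p)"
    unfolding transport_cost_def INF_less_iff by blast
  then show ?thesis using that by (auto simp: case_prod_unfold)
qed

text \<open>
  At the level \<open>e * v\<close> Markov's inequality gives \<open>(v / (e * v)) powr p = exp (- p)\<close>.
\<close>

lemma coupling_deviation:
  assumes \<pi>: "\<pi> \<in> couplings d \<mu> \<nu>" and p: "p > 0" and v: "v > 0"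
    and cost: "(\<integral>\<^sup>+ z. ennreal (vnorm d (\<lambda>i. fst z i - snd z i) powr p) \<partial>\<pi>) \<le> ennreal (v powr p)"
  shows "measure \<pi> {z \<in> space \<pi>. exp 1 * v \<le> vnorm d (\<lambda>i. fst z i - snd z i)} \<le> exp (- p)"
proof -
  interpret prob_space \<pi> using \<pi> by (simp add: couplings_def)
  have [measurable_cong]: "sets \<pi> = sets (Rd d \<Otimes>\<^sub>M Rd d)" using \<pi> by (simp add: couplings_def)
  let ?D = "\<lambda>z. vnorm d (\<lambda>i. fst z i - snd z i)"
  let ?t = "exp 1 * v"
  have t: "?t > 0" using v by simp
  have "emeasure \<pi> {z \<in> space \<pi>. ?t \<le> ?D z}
      \<le> emeasure \<pi> {z \<in> space \<pi>. 1 \<le> ennreal (?t powr - p) * ennreal (?D z powr p)}"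
  proof (rule emeasure_mono)
    have "1 \<le> ennreal (?t powr - p) * ennreal (?D z powr p)" if "?t \<le> ?D z" for z
    proof -
      have "?t powr p \<le> ?D z powr p" using that t p by (intro powr_mono2) auto
      then have "1 \<le> ?t powr - p * ?D z powr p"
        using t by (simp only: powr_minus_divide times_divide_eq_left mult_1 le_divide_eq_1_pos powr_gt_zero)
      then show ?thesis by (simp add: ennreal_mult[symmetric] ennreal_1[symmetric] del: ennreal_1)
    qed
    then show "{z \<in> space \<pi>. ?t \<le> ?D z} \<subseteq> {z \<in> space \<pi>. 1 \<le> ennreal (?t powr - p) * ennreal (?D z powr p)}"
      by auto
  qed measurable
  also have "\<dots> \<le> ennreal (?t powr - p) * (\<integral>\<^sup>+ z. ennreal (?D z powr p) * indicator (space \<pi>) z \<partial>\<pi>)"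
    by (rule nn_integral_Markov_inequality) measurable
  also have "(\<integral>\<^sup>+ z. ennreal (?D z powr p) * indicator (space \<pi>) z \<partial>\<pi>) = (\<integral>\<^sup>+ z. ennreal (?D z powr p) \<partial>\<pi>)"
    by (intro nn_integral_cong) auto
  also have "ennreal (?t powr - p) * \<dots> \<le> ennreal (?t powr - p) * ennreal (v powr p)"
    by (intro mult_left_mono cost) auto
  also have "\<dots> = ennreal (exp (- p))"
    using v by (simp add: ennreal_mult[symmetric] powr_mult powr_minus field_simps)
      (simp add: powr_def exp_minus field_simps)
  finally show ?thesis by (simp add: emeasure_eq_measure)
qed

lemma (in prob_space) tail_perturbation:
  fixes X Y D :: "'a \<Rightarrow> real"
  assumes [measurable]: "random_variable borel X" "random_variable borel Y" "random_variable borel D"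
    and tri: "\<And>w. X w \<le> Y w + D w"
  shows "prob {w \<in> space M. X w > x} \<le> prob {w \<in> space M. Y w > x - t} + prob {w \<in> space M. t \<le> D w}"
proof -
  have "prob {w \<in> space M. X w > x} \<le> prob ({w \<in> space M. Y w > x - t} \<union> {w \<in> space M. t \<le> D w})"
  proof (rule finite_measure_mono)
    show "{w \<in> space M. X w > x} \<subseteq> {w \<in> space M. Y w > x - t} \<union> {w \<in> space M. t \<le> D w}"
    proof
      fix w assume "w \<in> {w \<in> space M. X w > x}"
      then show "w \<in> {w \<in> space M. Y w > x - t} \<union> {w \<in> space M. t \<le> D w}"
        using tri[of w] by force
    qed
  qed measurable
  also have "\<dots> \<le> prob {w \<in> space M. Y w > x - t} + prob {w \<in> space M. t \<le> D w}"
    by (rule measure_Un_le) measurable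
  finally show ?thesis .
qed

lemma vnorm_triangle_diff: "vnorm d x \<le> vnorm d y + vnorm d (\<lambda>i. x i - y i)"
  unfolding vnorm_def using L2_set_triangle_ineq[of y "\<lambda>i. x i - y i" "{..<d}"] by simp

lemma vnorm_diff_commute: "vnorm d (\<lambda>i. x i - y i) = vnorm d (\<lambda>i. y i - x i)"
  unfolding vnorm_def L2_set_def by (simp add: power2_commute)

text \<open>
  The slack in the coupling is taken to be a factor \<open>2\<close>, hence the shift \<open>2 * exp 1 * w\<close>.
\<close>

lemma wasserstein_tail_comparison:
  assumes W: "wasserstein d p \<mu> \<nu> \<le> ennreal w" and p: "p > 0" and w: "w > 0"
  shows "norm_tail d \<mu> x \<le> norm_tail d \<nu> (x - 2 * exp 1 * w) + exp (- p)"
    and "norm_tail d \<nu> (x + 2 * exp 1 * w) \<le> norm_tail d \<mu> x + exp (- p)"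
proof -
  obtain \<pi> where \<pi>: "\<pi> \<in> couplings d \<mu> \<nu>"
    and cost: "(\<integral>\<^sup>+ z. ennreal (vnorm d (\<lambda>i. fst z i - snd z i) powr p) \<partial>\<pi>) \<le> ennreal ((2 * w) powr p)"
    using wasserstein_near_optimal_coupling[OF W p, of "2 * w"] w by auto
  interpret prob_space \<pi> using \<pi> by (simp add: couplings_def)
  have sets [measurable_cong]: "sets \<pi> = sets (Rd d \<Otimes>\<^sub>M Rd d)" using \<pi> by (simp add: couplings_def)
  let ?D = "\<lambda>z. vnorm d (\<lambda>i. fst z i - snd z i)"
  let ?t = "2 * exp 1 * w"
  have dev: "prob {z \<in> space \<pi>. ?t \<le> ?D z} \<le> exp (- p)"
    using coupling_deviation[OF \<pi> p _ cost] w by (simp add: mult_ac)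
  have \<mu>: "norm_tail d \<mu> y = prob {z \<in> space \<pi>. vnorm d (fst z) > y}"
    and \<nu>: "norm_tail d \<nu> y = prob {z \<in> space \<pi>. vnorm d (snd z) > y}" for y
  proof -
    have marg: "distr \<pi> (Rd d) fst = \<mu>" "distr \<pi> (Rd d) snd = \<nu>" using \<pi> by (auto simp: couplings_def)
    have m: "fst \<in> measurable \<pi> (Rd d)" "snd \<in> measurable \<pi> (Rd d)" by measurable
    have law: "norm_tail d (distr \<pi> (Rd d) X) y = prob {z \<in> space \<pi>. vnorm d (X z) > y}"
      if X: "X \<in> measurable \<pi> (Rd d)" for X
    proof -
      have "{w \<in> space (Rd d). vnorm d w > y} \<in> sets (Rd d)" by measurable
      moreover have "X -` {w \<in> space (Rd d). vnorm d w > y} \<inter> space \<pi> = {z \<in> space \<pi>. vnorm d (X z) > y}"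
        using measurable_space[OF X] by blast
      ultimately show ?thesis
        unfolding norm_tail_def space_distr using X by (simp only: measure_distr)
    qed
    show "norm_tail d \<mu> y = prob {z \<in> space \<pi>. vnorm d (fst z) > y}"
      using law[OF m(1)] by (simp only: marg)
    show "norm_tail d \<nu> y = prob {z \<in> space \<pi>. vnorm d (snd z) > y}"
      using law[OF m(2)] by (simp only: marg)
  qed
  have "norm_tail d \<mu> x \<le> norm_tail d \<nu> (x - ?t) + prob {z \<in> space \<pi>. ?t \<le> ?D z}"
    unfolding \<mu> \<nu> by (rule tail_perturbation) (measurable, rule vnorm_triangle_diff)
  then show "norm_tail d \<mu> x \<le> norm_tail d \<nu> (x - ?t) + exp (- p)"
    using dev by linarith
  have "prob {z \<in> space \<pi>. vnorm d (snd z) > x + ?t}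
      \<le> prob {z \<in> space \<pi>. vnorm d (fst z) > x + ?t - ?t} + prob {z \<in> space \<pi>. ?t \<le> ?D z}"
    by (rule tail_perturbation)
      (measurable, subst vnorm_diff_commute, rule vnorm_triangle_diff)
  then show "norm_tail d \<nu> (x + ?t) \<le> norm_tail d \<mu> x + exp (- p)"
    using dev unfolding \<mu> \<nu> by simp
qed


section \<open>The ratio of the tails\<close>

text \<open>
  Writing \<open>t = 2 * exp 1 * w\<close>, the bound \<open>K\<close> on \<open>t * x\<close> serves to linearize
  \<open>exp (t * x) \<le> 1 + t * x * exp (t * x)\<close>. The error \<open>exp (- p)\<close> is measured against
  \<open>exp (- x\<^sup>2 / 2)\<close>, which bounds the Gaussian tail from below.
\<close>

lemma tail_ratio_bound:
  assumes d: "d \<ge> 2" and x: "0 \<le> x" and w: "w > 0" and p: "p > 0"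
    and W: "wasserstein d p \<mu> (std_gaussian d) \<le> ennreal w"
    and e: "exp (- p) \<le> \<epsilon> * exp (- x\<^sup>2 / 2)"
    and K: "2 * exp 1 * w * x \<le> K" and K0: "K \<ge> 0"
  shows "\<bar>norm_tail d \<mu> x / norm_tail d (std_gaussian d) x - 1\<bar> \<le> 2 * exp 1 * w * (1 + x) * exp K + \<epsilon>"
proof -
  let ?S = "norm_tail d (std_gaussian d)"
  define t where "t = 2 * exp 1 * w"
  have t: "t > 0" using w by (simp add: t_def)
  have S: "?S x > 0" using std_gaussian_tail_lower[OF d x] by (rule less_le_trans[OF exp_gt_zero])
  have \<epsilon>: "\<epsilon> > 0"
  proof -
    have "0 < \<epsilon> * exp (- x\<^sup>2 / 2)" using e by (rule less_le_trans[OF exp_gt_zero])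
    then show ?thesis by (simp add: zero_less_mult_iff)
  qed
  have err: "exp (- p) \<le> \<epsilon> * ?S x"
    using e mult_left_mono[OF std_gaussian_tail_lower[OF d x], of \<epsilon>] \<epsilon> by linarith
  note comp = wasserstein_tail_comparison[OF W p w, of x, folded t_def]
  have tx: "t * x \<le> K" "0 \<le> t * x" using K t x by (auto simp: t_def)
  have exp_tx: "exp (t * x) \<le> 1 + t * (1 + x) * exp K"
  proof -
    have "(1 - t * x) \<le> exp (- (t * x))" using exp_ge_add_one_self[of "- (t * x)"] by simp
    then have "exp (t * x) * (1 - t * x) \<le> exp (t * x) * exp (- (t * x))" by (intro mult_left_mono) auto
    then have "exp (t * x) \<le> 1 + t * x * exp (t * x)"
      by (simp add: exp_add[symmetric] algebra_simps)
    also have "t * x * exp (t * x) \<le> t * (1 + x) * exp K"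
      using tx t x by (intro mult_mono) auto
    finally show ?thesis by simp
  qed
  have "norm_tail d \<mu> x \<le> (exp (t * x) + \<epsilon>) * ?S x"
    using comp(1) std_gaussian_tail_shift_left[OF d x, of t] err t by (simp add: algebra_simps)
  then have "norm_tail d \<mu> x / ?S x \<le> exp (t * x) + \<epsilon>"
    using S by (simp add: pos_divide_le_eq)
  moreover have "(1 - t * (1 + x) - \<epsilon>) * ?S x \<le> norm_tail d \<mu> x"
    using comp(2) std_gaussian_tail_shift_right[OF d x, of t] err t by (simp add: algebra_simps)
  then have "1 - t * (1 + x) - \<epsilon> \<le> norm_tail d \<mu> x / ?S x"
    using S by (simp add: pos_le_divide_eq)
  moreover have "t * (1 + x) \<le> t * (1 + x) * exp K"
    using mult_left_mono[of 1 "exp K" "t * (1 + x)"] t x K0 by simp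
  ultimately show ?thesis using exp_tx unfolding t_def[symmetric] by linarith
qed

lemma tail_ratio_trivial:
  assumes d: "d \<ge> 2" and x: "0 \<le> x" "x \<le> 1" and \<mu>: "prob_space \<mu>"
  shows "\<bar>norm_tail d \<mu> x / norm_tail d (std_gaussian d) x - 1\<bar> \<le> exp (1 / 2)"
proof -
  let ?S = "norm_tail d (std_gaussian d)"
  have "x\<^sup>2 \<le> 1" using x by (simp add: power_le_one)
  then have "exp (- 1 / 2) \<le> exp (- x\<^sup>2 / 2)" by simp
  also have "\<dots> \<le> ?S x" by (rule std_gaussian_tail_lower[OF d x(1)])
  finally have S: "exp (- 1 / 2) \<le> ?S x" .
  then have "?S x > 0" by (rule less_le_trans[OF exp_gt_zero])
  have "norm_tail d \<mu> x / ?S x \<le> 1 / exp (- 1 / 2)"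
    using S norm_tail_le_1[OF \<mu>] norm_tail_nonneg by (intro frac_le) auto
  also have "\<dots> = exp (1 / 2)" by (simp add: exp_minus field_simps)
  finally have "norm_tail d \<mu> x / ?S x \<le> exp (1 / 2)" .
  moreover have "0 \<le> norm_tail d \<mu> x / ?S x" by (simp add: norm_tail_nonneg)
  moreover have "1 \<le> exp (1 / 2 :: real)" by simp
  ultimately show ?thesis by linarith
qed

text \<open>
  With \<open>y = \<Delta> powr (- 1 / (2 * \<alpha> + 1)) \<ge> 1\<close>, the logarithm \<open>\<bar>ln \<Delta>\<bar>\<close> is \<open>(2 * \<alpha> + 1) * ln y\<close>, so both it
  and \<open>x\<^sup>2\<close> are at most a multiple of \<open>y\<^sup>2\<close>. The product on the left is then at most a multiple of
  \<open>y powr (2 * \<alpha> + 1) * \<Delta>\<close>, which is \<open>1\<close>: this is where the exponent in the range of \<open>x\<close> comes from.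
\<close>

lemma moment_order_cost_bound:
  fixes \<alpha> \<Delta> x :: real
  assumes \<alpha>: "\<alpha> \<ge> 0" and \<Delta>: "0 < \<Delta>" "\<Delta> \<le> 1" and x: "0 \<le> x" "x \<le> \<Delta> powr (- 1 / (2 * \<alpha> + 1))"
  shows "(max 1 (\<bar>ln \<Delta>\<bar> + x\<^sup>2 / 2)) powr \<alpha> * \<Delta> * x \<le> (2 * \<alpha> + 2) powr \<alpha>"
proof -
  define y where "y = \<Delta> powr (- 1 / (2 * \<alpha> + 1))"
  have lny: "ln y = \<bar>ln \<Delta>\<bar> / (2 * \<alpha> + 1)"
    using \<Delta> by (simp add: y_def ln_powr abs_if)
  have y0: "y > 0" using \<Delta> by (simp add: y_def)
  have y: "y \<ge> 1" using lny \<alpha> y0 by (metis abs_ge_zero divide_nonneg_nonneg ln_ge_zero_imp_ge_one add_nonneg_nonneg mult_nonneg_nonneg zero_le_numeral zero_le_one)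
  have y1: "y \<le> y\<^sup>2" using y by (simp add: power2_eq_square)
  have "\<bar>ln \<Delta>\<bar> = (2 * \<alpha> + 1) * ln y" using lny \<alpha> by simp
  also have "\<dots> \<le> (2 * \<alpha> + 1) * y\<^sup>2"
    using \<alpha> y1 ln_le_minus_one[OF y0] by (intro mult_left_mono) auto
  finally have "\<bar>ln \<Delta>\<bar> \<le> (2 * \<alpha> + 1) * y\<^sup>2" .
  moreover have xy: "x\<^sup>2 \<le> y\<^sup>2" using x by (simp add: y_def power_mono)
  moreover have "1 \<le> y\<^sup>2" using y y1 by linarith
  moreover have "0 \<le> 2 * \<alpha> * y\<^sup>2" using \<alpha> by simp
  ultimately have "max 1 (\<bar>ln \<Delta>\<bar> + x\<^sup>2 / 2) \<le> (2 * \<alpha> + 2) * y\<^sup>2"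
    by (simp add: algebra_simps)
  then have "(max 1 (\<bar>ln \<Delta>\<bar> + x\<^sup>2 / 2)) powr \<alpha> \<le> ((2 * \<alpha> + 2) * y\<^sup>2) powr \<alpha>"
    using \<alpha> by (intro powr_mono2) auto
  also have "\<dots> = (2 * \<alpha> + 2) powr \<alpha> * y powr (2 * \<alpha>)"
    using \<alpha> y0 by (simp add: powr_mult powr_powr flip: powr_numeral)
  finally have "(max 1 (\<bar>ln \<Delta>\<bar> + x\<^sup>2 / 2)) powr \<alpha> * \<Delta> * x
      \<le> ((2 * \<alpha> + 2) powr \<alpha> * y powr (2 * \<alpha>)) * \<Delta> * y"
    using x \<Delta> by (intro mult_mono) (auto simp: y_def)
  also have "\<dots> = (2 * \<alpha> + 2) powr \<alpha> * (y powr (2 * \<alpha> + 1) * \<Delta>)"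
    using y0 by (simp add: powr_add)
  also have "y powr (2 * \<alpha> + 1) * \<Delta> = 1"
  proof -
    have "- 1 / (2 * \<alpha> + 1) * (2 * \<alpha> + 1) = - 1" using \<alpha> by simp
    then show ?thesis using \<Delta> by (simp only: y_def powr_powr) (simp add: powr_minus)
  qed
  finally show ?thesis by simp
qed

theorem theorem4p2:
  fixes \<alpha> A B1 B2 :: real
  assumes "\<alpha> \<ge> 0" and "A > 0"
  shows "\<exists>C>0. \<forall>(d::nat) (\<mu> :: (nat \<Rightarrow> real) measure) (\<Delta>::real) (p0::real).
     d \<ge> 2 \<longrightarrow> random_vector_law d \<mu> \<longrightarrow> \<Delta> > 0 \<longrightarrow>
     (\<forall>p::real. 1 \<le> p \<and> p \<le> p0 \<longrightarrow>
        wasserstein d p \<mu> (std_gaussian d) \<le> ennreal (A * p powr \<alpha> * \<Delta>)) \<longrightarrow>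
     \<bar>ln \<Delta>\<bar> \<le> p0 / 4 \<longrightarrow> ln (kappa d) \<le> p0 / 4 \<longrightarrow>
     real d * (real d * ln (real d)) powr \<alpha> * \<Delta> \<le> B1 \<longrightarrow>
     (0 < \<alpha> \<and> \<alpha> \<le> 1 / 2 \<longrightarrow> real d * \<Delta> * \<bar>ln \<Delta>\<bar> powr \<alpha> \<le> B2) \<longrightarrow>
     (\<forall>x::real. 0 \<le> x \<and> x \<le> min (\<Delta> powr (- 1 / (2 * \<alpha> + 1))) (sqrt p0) \<longrightarrow>
        \<bar>norm_tail d \<mu> x / norm_tail d (std_gaussian d) x - 1\<bar>
          \<le> C * (1 + x) * (\<bar>ln \<Delta>\<bar> + real d * ln (real d) + x\<^sup>2) powr \<alpha> * \<Delta>)"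
proof -
  define K where "K = 2 * exp 1 * A * (2 * \<alpha> + 2) powr \<alpha>"
  \<comment> \<open>The summand \<open>exp 1\<close> covers the case \<open>x \<le> 1\<close> with \<open>\<Delta> \<ge> exp (- 1 / 2)\<close>, and also the error \<open>\<Delta>\<close> in the main case.\<close>
  define C where "C = exp 1 + 2 * exp 1 * A * exp K"
  have K: "K \<ge> 0" using assms by (simp add: K_def)
  have C: "C > 0" "exp 1 \<le> C" "1 + 2 * exp 1 * A * exp K \<le> C"
    using assms by (auto simp: C_def intro!: add_pos_pos)
  have bound: "\<bar>norm_tail d \<mu> x / norm_tail d (std_gaussian d) x - 1\<bar>
          \<le> C * (1 + x) * (\<bar>ln \<Delta>\<bar> + real d * ln (real d) + x\<^sup>2) powr \<alpha> * \<Delta>"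
    if d: "d \<ge> 2" and \<mu>: "random_vector_law d \<mu>" and \<Delta>: "\<Delta> > 0"
      and W: "\<And>p. 1 \<le> p \<and> p \<le> p0 \<Longrightarrow> wasserstein d p \<mu> (std_gaussian d) \<le> ennreal (A * p powr \<alpha> * \<Delta>)"
      and p0: "\<bar>ln \<Delta>\<bar> \<le> p0 / 4"
      and x: "0 \<le> x" "x \<le> \<Delta> powr (- 1 / (2 * \<alpha> + 1))" "x \<le> sqrt p0"
    for d \<mu> \<Delta> p0 x
  proof -
    define L where "L = \<bar>ln \<Delta>\<bar> + real d * ln (real d) + x\<^sup>2"
    \<comment> \<open>This makes the base of the power in the claim at least \<open>1\<close>, so that it also bounds \<open>p\<close> when \<open>p = 1\<close>.\<close>
    have dlnd: "1 \<le> real d * ln (real d)"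
    proof -
      have "1 / 2 \<le> ln (2::real)" using ln2_ge_two_thirds by simp
      also have "ln 2 \<le> ln (real d)" using d by simp
      finally have "2 * (1 / 2) \<le> real d * ln (real d)" using d by (intro mult_mono) auto
      then show ?thesis by simp
    qed
    have L: "L \<ge> 1" "L powr \<alpha> \<ge> 1"
    proof -
      show "L \<ge> 1"
        unfolding L_def using dlnd abs_ge_zero[of "ln \<Delta>"] zero_le_power2[of x] by linarith
      then show "L powr \<alpha> \<ge> 1" using assms by (simp add: ge_one_powr_ge_zero)
    qed
    have "\<bar>norm_tail d \<mu> x / norm_tail d (std_gaussian d) x - 1\<bar> \<le> C * (1 + x) * L powr \<alpha> * \<Delta>"
    proof (cases "\<Delta> \<ge> 1 \<or> p0 < 1")
      case True
      have "x \<le> 1" and "exp (- 1 / 2) \<le> \<Delta>"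
      proof -
        have "\<Delta> powr (- 1 / (2 * \<alpha> + 1)) \<le> 1" if "\<Delta> \<ge> 1"
          using that assms powr_mono[of "- 1 / (2 * \<alpha> + 1)" 0 \<Delta>] by simp
        moreover have "sqrt p0 \<le> 1" if "p0 < 1" using that by simp
        ultimately show "x \<le> 1" using True x by linarith
        have "- 1 / 2 \<le> ln \<Delta>"
        proof (cases "\<Delta> \<ge> 1")
          case True
          then have "0 \<le> ln \<Delta>" by simp
          then show ?thesis by linarith
        next
          case False
          then show ?thesis using True p0 by linarith
        qed
        then show "exp (- 1 / 2) \<le> \<Delta>" using \<Delta> by (simp add: ln_ge_iff)
      qed
      have "\<bar>norm_tail d \<mu> x / norm_tail d (std_gaussian d) x - 1\<bar> \<le> exp (1 / 2)"
        using tail_ratio_trivial[OF d x(1) \<open>x \<le> 1\<close>] \<mu> by (simp add: random_vector_law_def)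
      also have "\<dots> = exp 1 * 1 * 1 * exp (- 1 / 2)" by (simp add: exp_add[symmetric])
      also have "\<dots> \<le> C * (1 + x) * L powr \<alpha> * \<Delta>"
        using C L x \<open>exp (- 1 / 2) \<le> \<Delta>\<close> by (intro mult_mono) auto
      finally show ?thesis .
    next
      case False
      define p where "p = max 1 (\<bar>ln \<Delta>\<bar> + x\<^sup>2 / 2)"
      define w where "w = A * p powr \<alpha> * \<Delta>"
      have p1: "p \<ge> 1" by (simp add: p_def)
      have "x\<^sup>2 \<le> p0" using power_mono[OF x(3) x(1), of 2] False by simp
      then have "p \<le> p0" using p0 False by (simp add: p_def)
      then have Wp: "wasserstein d p \<mu> (std_gaussian d) \<le> ennreal w"
        using W p1 by (simp add: w_def)
      have w: "w > 0" using p1 assms \<Delta> by (simp add: w_def)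
      have "ln \<Delta> < 0" using False \<Delta> by simp
      then have "- p \<le> ln \<Delta> + - x\<^sup>2 / 2" unfolding p_def by simp
      then have "exp (- p) \<le> exp (ln \<Delta> + - x\<^sup>2 / 2)" by simp
      then have e: "exp (- p) \<le> \<Delta> * exp (- x\<^sup>2 / 2)" using \<Delta> by (simp only: exp_add exp_ln)
      have "2 * exp 1 * w * x = 2 * exp 1 * A * (p powr \<alpha> * \<Delta> * x)" by (simp add: w_def)
      also have "\<dots> \<le> K" unfolding K_def p_def
        using assms \<Delta> False x by (intro mult_left_mono moment_order_cost_bound) auto
      finally have wx: "2 * exp 1 * w * x \<le> K" .
      have "p \<le> L"
        unfolding p_def L_def using dlnd abs_ge_zero[of "ln \<Delta>"] zero_le_power2[of x]
        by (intro max.boundedI) linarith+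
      then have pL: "p powr \<alpha> \<le> L powr \<alpha>" using p1 assms by (intro powr_mono2) auto
      have "\<bar>norm_tail d \<mu> x / norm_tail d (std_gaussian d) x - 1\<bar>
          \<le> 2 * exp 1 * w * (1 + x) * exp K + \<Delta>"
        by (rule tail_ratio_bound[OF d x(1) w _ Wp e wx K]) (use p1 in simp)
      also have "\<dots> = (2 * exp 1 * A * exp K) * ((1 + x) * p powr \<alpha> * \<Delta>) + \<Delta>"
        by (simp add: w_def)
      also have "\<dots> \<le> (2 * exp 1 * A * exp K) * ((1 + x) * L powr \<alpha> * \<Delta>) + (1 + x) * L powr \<alpha> * \<Delta>"
      proof (rule add_mono)
        have "(1 + x) * p powr \<alpha> * \<Delta> \<le> (1 + x) * L powr \<alpha> * \<Delta>"
          using pL x \<Delta> by (intro mult_right_mono mult_left_mono) auto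
        then show "(2 * exp 1 * A * exp K) * ((1 + x) * p powr \<alpha> * \<Delta>)
            \<le> (2 * exp 1 * A * exp K) * ((1 + x) * L powr \<alpha> * \<Delta>)"
          using assms(2) by (intro mult_left_mono) auto
        have "1 * 1 \<le> (1 + x) * L powr \<alpha>" using x L by (intro mult_mono) auto
        then show "\<Delta> \<le> (1 + x) * L powr \<alpha> * \<Delta>" using \<Delta> by simp
      qed
      also have "\<dots> = (1 + 2 * exp 1 * A * exp K) * ((1 + x) * L powr \<alpha> * \<Delta>)"
        by (simp only: distrib_right mult_1 add.commute)
      also have "\<dots> = (1 + 2 * exp 1 * A * exp K) * (1 + x) * L powr \<alpha> * \<Delta>"
        by (simp only: mult.assoc)
      also have "\<dots> \<le> C * (1 + x) * L powr \<alpha> * \<Delta>"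
        using C x \<Delta> by (intro mult_right_mono) auto
      finally show ?thesis .
    qed
    then show ?thesis by (simp only: L_def)
  qed
  show ?thesis
  proof (intro exI[of _ C] conjI allI impI C(1), elim conjE)
    fix d :: nat and \<mu> :: "(nat \<Rightarrow> real) measure" and \<Delta> p0 x :: real
    assume "2 \<le> d" "random_vector_law d \<mu>" "0 < \<Delta>"
      and W: "\<forall>p. 1 \<le> p \<and> p \<le> p0 \<longrightarrow>
          wasserstein d p \<mu> (std_gaussian d) \<le> ennreal (A * p powr \<alpha> * \<Delta>)"
      and "\<bar>ln \<Delta>\<bar> \<le> p0 / 4" "0 \<le> x"
      and x: "x \<le> min (\<Delta> powr (- 1 / (2 * \<alpha> + 1))) (sqrt p0)"
    moreover note W[rule_format] min.boundedE[OF x]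
    ultimately show "\<bar>norm_tail d \<mu> x / norm_tail d (std_gaussian d) x - 1\<bar>
        \<le> C * (1 + x) * (\<bar>ln \<Delta>\<bar> + real d * ln (real d) + x\<^sup>2) powr \<alpha> * \<Delta>"
      by (intro bound[of d \<mu> \<Delta> p0 x]) auto
  qed
qed

end
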